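(* Let $\mathbb{X}$ be a smooth real Banach space and let $T \in \mathbb{L}(\mathbb{X})$ be an isometry. If $x \in \mathbb{X}$ is a left symmetric point, then $Tx$ is also a left symmetric point.
   Context: $\mathbb{L}(\mathbb{X})$ is the space of bounded linear operators on $\mathbb{X}$. For $x,y \in \mathbb{X}$, $x \perp_B y$ (Birkhoff-James orthogonality) means $\|x\| \le \|x + \lambda y\|$ for all $\lambda \in \mathbb{R}$. A point $x \in \mathbb{X}$ is left symmetric if for every $y \in \mathbb{X}$, $x \perp_B y$ implies $y \perp_B x$. A Banach space is smooth if each point $x$ of its unit sphere has a unique norm-one functional $f$ with $f(x) = 1$.
   Formalization: The isometry T is additionally assumed to be onto; for isometries that only preserve the norm the claim is false, e.g. on real l_3 with T e_1 = 3^(-1/3)(e_1+e_2+e_3) and T e_n = e_(n+2) for n ≥ 2, where e_1 is left symmetric but T e_1 is not. *)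

theory Defs
  imports "HOL-Analysis.Analysis"
begin

definition birkhoff_orth :: "'a::real_normed_vector \<Rightarrow> 'a \<Rightarrow> bool"  (infix "\<bottom>\<^sub>B" 50)
  where "x \<bottom>\<^sub>B y \<longleftrightarrow> (\<forall>l::real. norm x \<le> norm (x + l *\<^sub>R y))"

definition left_symmetric :: "'a::real_normed_vector \<Rightarrow> bool"
  where "left_symmetric x \<longleftrightarrow> (\<forall>y. x \<bottom>\<^sub>B y \<longrightarrow> y \<bottom>\<^sub>B x)"

definition smooth_space :: "'a::real_normed_vector itself \<Rightarrow> bool"
  where "smooth_space _ \<longleftrightarrow>
    (\<forall>x::'a. norm x = 1 \<longrightarrow> (\<exists>!f::'a \<Rightarrow>\<^sub>L real. norm f = 1 \<and> blinfun_apply f x = 1))"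

(* Isometries of a Banach space are taken to be onto. Left symmetry of T x tests T x against all
   vectors, not just those in the range of T, and is not preserved by isometric embeddings in
   general: on real l_p (1 < p < \<infinity>, p \<noteq> 2), map the basis vector e_1 to
   3 powr (- 1/p) (e_1 + e_2 + e_3) and e_n to e_(n+2) for n \<ge> 2. Then e_1 is left symmetric,
   but its image is orthogonal to y = 2 e_1 - e_2 - e_3 and not conversely. *)
definition surjective_isometry :: "('a::real_normed_vector \<Rightarrow>\<^sub>L 'a) \<Rightarrow> bool"
  where "surjective_isometry T \<longleftrightarrow>
    (\<forall>x. norm (blinfun_apply T x) = norm x) \<and> surj (blinfun_apply T)"

end

theory Submission imports Defs begin

text \<open>Birkhoff-James orthogonality is expressed by the norm and the linear structure alone, so a
  linear isometry both preserves and reflects it. Left symmetry of \<open>T x\<close> quantifies over all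
  vectors; surjectivity writes each of them as \<open>T z\<close>, and the condition on \<open>T x\<close> and \<open>T z\<close>
  pulls back to the one on \<open>x\<close> and \<open>z\<close>.\<close>

lemma birkhoff_orth_isometry_iff:
  fixes T :: "'a::real_normed_vector \<Rightarrow>\<^sub>L 'b::real_normed_vector"
  assumes "\<And>v. norm (blinfun_apply T v) = norm v"
  shows "blinfun_apply T x \<bottom>\<^sub>B blinfun_apply T y \<longleftrightarrow> x \<bottom>\<^sub>B y"
proof -
  have "norm (blinfun_apply T x + l *\<^sub>R blinfun_apply T y) = norm (x + l *\<^sub>R y)" for l
    using assms[of "x + l *\<^sub>R y"] by (simp add: blinfun.add_right blinfun.scaleR_right)
  then show ?thesis
    by (simp add: birkhoff_orth_def assms)
qed

theorem corollary2p2p4: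
  fixes T :: "'a::banach \<Rightarrow>\<^sub>L 'a" and x :: 'a
  assumes "smooth_space TYPE('a)"
    and "surjective_isometry T"
    and "left_symmetric x"
  shows "left_symmetric (blinfun_apply T x)"
  unfolding left_symmetric_def
proof (intro allI impI)
  fix y
  assume orth: "blinfun_apply T x \<bottom>\<^sub>B y"
  have iso: "norm (blinfun_apply T v) = norm v" for v
    using assms(2) by (simp add: surjective_isometry_def)
  obtain z where y: "y = blinfun_apply T z"
    using assms(2) by (auto simp: surjective_isometry_def surj_def)
  have "x \<bottom>\<^sub>B z"
    using orth by (simp add: y birkhoff_orth_isometry_iff[OF iso])
  then have "z \<bottom>\<^sub>B x"
    using assms(3) by (simp add: left_symmetric_def)
  then show "y \<bottom>\<^sub>B blinfun_apply T x"
    by (simp add: y birkhoff_orth_isometry_iff[OF iso])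
qed

end
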